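(* Let $K$ be a field, let $\mathcal{O}=\{t_1,\dots,t_\mu\}$ be an order ideal of terms in $\mathbb{T}^n$ with border $\partial\mathcal{O}=\{b_1,\dots,b_\nu\}$, let $C=\{c_{ij}\mid 1\le i\le\mu,\ 1\le j\le\nu\}$, and let $I(\mathbb{B}_{\mathcal{O}})\subseteq K[C]$ be the defining ideal of the $\mathcal{O}$-border basis scheme. Let $Z$ be a tuple of distinct indeterminates from $C$ (of length at least $1$) such that there exists a $Z$-separating re-embedding of $I(\mathbb{B}_{\mathcal{O}})$ (i.e., such that $I(\mathbb{B}_{\mathcal{O}})$ is $Z$-separating), and let $Y=C\setminus Z$. (a) All basic indeterminates of $C$ are rim indeterminates. (b) Each proper cotangent equivalence class in $C$ contains a rim indeterminate.
   Context: $\mathbb{T}^n$ is the monoid of terms $x_1^{\alpha_1}\cdots x_n^{\alpha_n}$. An order ideal $\mathcal{O}=\{t_1,\dots,t_\mu\}$ is a finite non-empty set of terms closed under taking divisors; its border is $\partial\mathcal{O}=(x_1\mathcal{O}\cup\cdots\cup x_n\mathcal{O})\setminus\mathcal{O}$. The $c_{ij}$ are indeterminates over $K$. For $k=1,\dots,n$, the generic multiplication matrix $\mathcal{A}_k\in\mathrm{Mat}_\mu(K[C])$ has $j$-th column equal to the $m$-th unit vector if $x_kt_j=t_m\in\mathcal{O}$, and equal to $(c_{1m},\dots,c_{\mu m})^{\mathrm{tr}}$ if $x_kt_j=b_m\in\partial\mathcal{O}$. The ideal $I(\mathbb{B}_{\mathcal{O}})$ of $K[C]$ is generated by all entries of the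 commutators $\mathcal{A}_i\mathcal{A}_j-\mathcal{A}_j\mathcal{A}_i$ with $1\le i<j\le n$. It is contained in the maximal ideal $\mathfrak{M}=\langle C\rangle$ of $K[C]$ generated by all $c_{ij}$. For a tuple $Z=(z_1,\dots,z_s)$ of distinct indeterminates from $C$, an ideal $I\subseteq\mathfrak{M}$ of $K[C]$ is $Z$-separating if there exist a term ordering $\sigma$ on the terms of $K[C]$ and $f_1,\dots,f_s\in I\setminus\{0\}$ with $\mathrm{LT}_\sigma(f_i)=z_i$ for $i=1,\dots,s$; in this case there is an induced isomorphism $K[C]/I\to K[Y]/(I\cap K[Y])$ called the $Z$-separating re-embedding of $I$. Let $\mathfrak{m}$ be the image of $\mathfrak{M}$ in $K[C]/I(\mathbb{B}_{\mathcal{O}})$, and let $\bar c_{ij}$ be the residue class of $c_{ij}$ in the cotangent space $\mathfrak{m}/\mathfrak{m}^2$. Cotangent equivalence on $C$ is defined by $c_{ij}\sim c_{i'j'}\Leftrightarrow\langle\bar c_{ij}\rangle_K=\langle\bar c_{i'j'}\rangle_K$. An indeterminate $c_{ij}$ is trivial if $\bar c_{ij}=0$. A non-trivial indeterminate and its equivalence class are called basic if the class consists of this indeterminate only, and proper if the class contains at least two elements. The rim $\mathcal{O}^\nabla$ of $\mathcal{O}$ consists of all $t_i\in\mathcal{O}$ such that $x_kt_i\in\partial\mathcal{O}$ for some $k\in\{1,\dots,n\}$. The indeterminate $c_{ij}$ is a rim indeterminate if $t_i\in\mathcal{O}^\nabla$. *)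

theory Defs
  imports
    "HOL-Library.Poly_Mapping"
    "HOL-Algebra.QuotRing"
    "HOL-Algebra.Ideal_Product"
    "Jordan_Normal_Form.Matrix"
begin

text \<open>
  Terms (power products) in indeterminates of type \<open>'v\<close> are finitely supported exponent functions
  \<open>'v \<Rightarrow>\<^sub>0 nat\<close>, so the product of terms is \<open>+\<close> and the term 1 is \<open>0\<close>. Polynomials are finitely
  supported functions from terms to coefficients, with the convolution product of
  \<^theory>\<open>HOL-Library.Poly_Mapping\<close>. All enumerations start at 0: the indeterminates of the
  polynomial ring containing the order ideal are \<open>x\<^sub>k\<close> with \<open>k < n\<close>, and \<open>c\<^sub>i\<^sub>j\<close> is the pair \<open>(i, j)\<close>.
\<close>

type_synonym 'v trm = "'v \<Rightarrow>\<^sub>0 nat"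
type_synonym ('v, 'k) mpoly = "('v \<Rightarrow>\<^sub>0 nat) \<Rightarrow>\<^sub>0 'k"

definition terms_in :: "'v set \<Rightarrow> 'v trm set" where
  "terms_in V = {t. Poly_Mapping.keys t \<subseteq> V}"

definition indet_term :: "'v \<Rightarrow> 'v trm" where
  "indet_term v = Poly_Mapping.single v 1"

definition term_dvd :: "'v trm \<Rightarrow> 'v trm \<Rightarrow> bool" where
  "term_dvd s t \<longleftrightarrow> (\<exists>u. t = s + u)"


section \<open>Order ideals\<close>

definition order_ideal :: "nat \<Rightarrow> nat trm set \<Rightarrow> bool" where
  "order_ideal n Oid \<longleftrightarrow> finite Oid \<and> Oid \<noteq> {} \<and> Oid \<subseteq> terms_in {..<n} \<and>
     (\<forall>t\<in>Oid. \<forall>s\<in>terms_in {..<n}. term_dvd s t \<longrightarrow> s \<in> Oid)"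

definition border :: "nat \<Rightarrow> nat trm set \<Rightarrow> nat trm set" where
  "border n Oid = (\<Union>k<n. (\<lambda>t. indet_term k + t) ` Oid) - Oid"

definition rim :: "nat \<Rightarrow> nat trm set \<Rightarrow> nat trm set" where
  "rim n Oid = {t \<in> Oid. \<exists>k<n. indet_term k + t \<in> border n Oid}"

definition rim_indet :: "nat \<Rightarrow> nat trm list \<Rightarrow> nat \<times> nat \<Rightarrow> bool" where
  "rim_indet n ts c \<longleftrightarrow> ts ! fst c \<in> rim n (set ts)"


section \<open>Polynomial rings\<close>

definition mpoly_ring :: "'v set \<Rightarrow> ('v, 'k::field) mpoly ring" where
  "mpoly_ring V = \<lparr>carrier = {p. Poly_Mapping.keys p \<subseteq> terms_in V},
     monoid.mult = (*), one = 1, zero = 0, add = (+)\<rparr>"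

definition poly_indet :: "'v \<Rightarrow> ('v, 'k::field) mpoly" where
  "poly_indet v = Poly_Mapping.single (indet_term v) 1"

definition poly_const :: "'k \<Rightarrow> ('v, 'k::field) mpoly" where
  "poly_const a = Poly_Mapping.single 0 a"

definition indet_ideal :: "'v set \<Rightarrow> ('v, 'k::field) mpoly set" where
  "indet_ideal V = genideal (mpoly_ring V) (poly_indet ` V)"


section \<open>The border basis scheme\<close>

definition position :: "'a list \<Rightarrow> 'a \<Rightarrow> nat" where
  "position xs x = (THE m. m < length xs \<and> xs ! m = x)"

text \<open>The lists \<open>ts\<close> and \<open>bs\<close> enumerate the order ideal and its border.\<close>

definition generic_mult_mat ::
    "nat trm list \<Rightarrow> nat trm list \<Rightarrow> nat \<Rightarrow> (nat \<times> nat, 'k::field) mpoly mat" where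
  "generic_mult_mat ts bs k = mat_of_cols (length ts)
     (map (\<lambda>t. let s = indet_term k + t in
             if s \<in> set ts then unit_vec (length ts) (position ts s)
             else vec (length ts) (\<lambda>i. poly_indet (i, position bs s)))
        ts)"

definition coord_indets :: "nat trm list \<Rightarrow> nat trm list \<Rightarrow> (nat \<times> nat) set" where
  "coord_indets ts bs = {..<length ts} \<times> {..<length bs}"

definition border_scheme_ideal ::
    "nat \<Rightarrow> nat trm list \<Rightarrow> nat trm list \<Rightarrow> (nat \<times> nat, 'k::field) mpoly set" where
  "border_scheme_ideal n ts bs = genideal (mpoly_ring (coord_indets ts bs))
     (\<Union>j<n. \<Union>i<j. elements_mat
        (generic_mult_mat ts bs i * generic_mult_mat ts bs j
          - generic_mult_mat ts bs j * generic_mult_mat ts bs i))"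


section \<open>Separating re-embeddings\<close>

text \<open>A pair \<open>(s, t) \<in> \<sigma>\<close> means \<open>s \<le>\<^sub>\<sigma> t\<close>.\<close>

definition term_ordering :: "'v set \<Rightarrow> ('v trm \<times> 'v trm) set \<Rightarrow> bool" where
  "term_ordering V \<sigma> \<longleftrightarrow> linear_order_on (terms_in V) \<sigma> \<and>
     (\<forall>t\<in>terms_in V. (0, t) \<in> \<sigma>) \<and>
     (\<forall>s\<in>terms_in V. \<forall>t\<in>terms_in V. \<forall>u\<in>terms_in V. (s, t) \<in> \<sigma> \<longrightarrow> (s + u, t + u) \<in> \<sigma>)"

definition leading_term :: "('v trm \<times> 'v trm) set \<Rightarrow> ('v, 'k::field) mpoly \<Rightarrow> 'v trm" where
  "leading_term \<sigma> f =
     (THE t. t \<in> Poly_Mapping.keys f \<and> (\<forall>s\<in>Poly_Mapping.keys f. (s, t) \<in> \<sigma>))"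

text \<open>\<open>I\<close> is meant to be an ideal of \<open>mpoly_ring V\<close> contained in \<open>indet_ideal V\<close>.\<close>

definition separating :: "'v set \<Rightarrow> ('v, 'k::field) mpoly set \<Rightarrow> 'v list \<Rightarrow> bool" where
  "separating V I Z \<longleftrightarrow> (\<exists>\<sigma> f. term_ordering V \<sigma> \<and>
     (\<forall>i<length Z. f i \<in> I - {0} \<and> leading_term \<sigma> (f i) = indet_term (Z ! i)))"


section \<open>Cotangent equivalence\<close>

definition residue_max_ideal ::
    "'v set \<Rightarrow> ('v, 'k::field) mpoly set \<Rightarrow> ('v, 'k) mpoly set set" where
  "residue_max_ideal V I = (\<lambda>p. I +>\<^bsub>mpoly_ring V\<^esub> p) ` indet_ideal V"

definition residue_max_ideal_sq ::
    "'v set \<Rightarrow> ('v, 'k::field) mpoly set \<Rightarrow> ('v, 'k) mpoly set set" where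
  "residue_max_ideal_sq V I =
     ideal_prod (mpoly_ring V Quot I) (residue_max_ideal V I) (residue_max_ideal V I)"

text \<open>
  The cotangent space \<open>\<mm>/\<mm>\<^sup>2\<close> is the image of \<open>\<mm>\<close> in the ring \<open>(K[V]/I)/\<mm>\<^sup>2\<close>; the latter is a
  \<open>K\<close>-algebra via the residue classes of constants, which gives the \<open>K\<close>-vector space structure.
\<close>

definition cotangent_ring ::
    "'v set \<Rightarrow> ('v, 'k::field) mpoly set \<Rightarrow> ('v, 'k) mpoly set set ring" where
  "cotangent_ring V I = (mpoly_ring V Quot I) Quot residue_max_ideal_sq V I"

definition residue ::
    "'v set \<Rightarrow> ('v, 'k::field) mpoly set \<Rightarrow> ('v, 'k) mpoly \<Rightarrow> ('v, 'k) mpoly set set" where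
  "residue V I p =
     residue_max_ideal_sq V I +>\<^bsub>mpoly_ring V Quot I\<^esub> (I +>\<^bsub>mpoly_ring V\<^esub> p)"

definition cotangent_line ::
    "'v set \<Rightarrow> ('v, 'k::field) mpoly set \<Rightarrow> 'v \<Rightarrow> ('v, 'k) mpoly set set set" where
  "cotangent_line V I c =
     {residue V I (poly_const a) \<otimes>\<^bsub>cotangent_ring V I\<^esub> residue V I (poly_indet c) | a. True}"

definition cotangent_equiv :: "'v set \<Rightarrow> ('v, 'k::field) mpoly set \<Rightarrow> ('v \<times> 'v) set" where
  "cotangent_equiv V I =
     {(c, d). c \<in> V \<and> d \<in> V \<and> cotangent_line V I c = cotangent_line V I d}"

definition trivial_indet :: "'v set \<Rightarrow> ('v, 'k::field) mpoly set \<Rightarrow> 'v \<Rightarrow> bool" where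
  "trivial_indet V I c \<longleftrightarrow> c \<in> V \<and> residue V I (poly_indet c) = \<zero>\<^bsub>cotangent_ring V I\<^esub>"

definition basic_indet :: "'v set \<Rightarrow> ('v, 'k::field) mpoly set \<Rightarrow> 'v \<Rightarrow> bool" where
  "basic_indet V I c \<longleftrightarrow> c \<in> V \<and> \<not> trivial_indet V I c \<and> cotangent_equiv V I `` {c} = {c}"

definition proper_class :: "'v set \<Rightarrow> ('v, 'k::field) mpoly set \<Rightarrow> 'v set \<Rightarrow> bool" where
  "proper_class V I E \<longleftrightarrow> E \<in> V // cotangent_equiv V I \<and>
     (\<forall>c\<in>E. \<not> trivial_indet V I c) \<and> (\<exists>c\<in>E. \<exists>d\<in>E. c \<noteq> d)"

end

theory Submission
  imports Defs
begin

text \<open>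
  Modulo products of two indeterminates, every entry of a commutator of generic multiplication
  matrices is a difference of two indeterminates, a single indeterminate up to sign, or 0. View
  \<open>c\<^sub>i\<^sub>j\<close> as an arrow from \<open>b\<^sub>j\<close> to \<open>t\<^sub>i\<close>. The entries then say that an arrow may be translated along the
  border without changing its cotangent class, and that the class is 0 once the head of the arrow
  would get a negative exponent. Since \<open>t\<^sub>i\<close> is not a multiple of \<open>b\<^sub>j\<close>, the arrow can be translated so
  that a suitable exponent of the head falls until the class is seen to be 0 or the head lies in
  the rim. Translations need two indeterminates \<open>x\<^sub>k\<close>; for \<open>n \<le> 1\<close> the ideal is 0 and not
  separating.
\<close>

section \<open>Walking along the border\<close>

text \<open>Exponents are natural numbers, so nothing cancels in \<open>s + u\<close>. Hence
  \<open>s\<close> involves only indeterminates of \<open>s + u\<close>, and membership in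
  \<open>terms_in\<close> comes for free.\<close>

lemma order_ideal_dvd_closed:
  assumes "order_ideal n Oid" "s + u \<in> Oid"
  shows "s \<in> Oid"
proof -
  have "Poly_Mapping.keys (s + u) \<subseteq> {..<n}"
    using assms by (auto simp: order_ideal_def terms_in_def)
  moreover have "Poly_Mapping.keys s \<subseteq> Poly_Mapping.keys (s + u)"
    by (auto simp: in_keys_iff lookup_add)
  ultimately have "s \<in> terms_in {..<n}"
    by (auto simp: terms_in_def)
  then show ?thesis
    using assms unfolding order_ideal_def term_dvd_def by blast
qed

lemma order_ideal_indet_cancel:
  assumes "order_ideal n Oid" "indet_term k + t \<in> Oid"
  shows "t \<in> Oid"
  using order_ideal_dvd_closed[of n Oid t "indet_term k"] assms by (simp add: add.commute)

lemma lookup_indet_term: "Poly_Mapping.lookup (indet_term k) i = (if k = i then 1 else 0)"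
  by (simp add: indet_term_def lookup_single when_def)

lemma indet_term_plus_minus:
  assumes "Poly_Mapping.lookup t k > 0"
  shows "indet_term k + (t - indet_term k) = t"
  using assms by (intro poly_mapping_eqI) (auto simp: lookup_add lookup_minus lookup_indet_term)

text \<open>
  Here \<open>f t b\<close> plays the role of the cotangent class of the arrow from \<open>b\<close> to \<open>t\<close>. The steps leave the
  vector \<open>t - b\<close> unchanged, so an exponent with \<open>t\<^sub>k < b\<^sub>k\<close> keeps this property. Choosing each
  step so that either \<open>t\<^sub>k\<close> drops, or \<open>t\<^sub>k\<close> stays and \<open>t\<close> is multiplied by another indeterminate,
  forces the walk to end, which happens only at the rim or at \<open>z\<close>.
\<close>

lemma arrow_reaches_rim:
  fixes f :: "nat trm \<Rightarrow> nat trm \<Rightarrow> 'a" and z :: 'a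
  defines "g \<equiv> \<lambda>k s b. if Poly_Mapping.lookup s k > 0 then f (s - indet_term k) b else z"
  assumes n: "n \<ge> 2" and Oid: "order_ideal n Oid"
    and next_door: "\<And>k l m s. k < n \<Longrightarrow> l < n \<Longrightarrow> k \<noteq> l \<Longrightarrow> s \<in> Oid \<Longrightarrow>
      indet_term l + m \<in> border n Oid \<Longrightarrow> indet_term k + m \<in> Oid \<Longrightarrow>
      g k s (indet_term l + m) = f s (indet_term k + (indet_term l + m))"
    and across: "\<And>k l m s. k < n \<Longrightarrow> l < n \<Longrightarrow> k \<noteq> l \<Longrightarrow> s \<in> Oid \<Longrightarrow> m \<in> Oid \<Longrightarrow>
      indet_term l + m \<in> border n Oid \<Longrightarrow> indet_term k + m \<in> border n Oid \<Longrightarrow>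
      g k s (indet_term l + m) = g l s (indet_term k + m)"
    and t: "t \<in> Oid" and b: "b \<in> border n Oid"
  shows "f t b = z \<or> (\<exists>t'\<in>rim n Oid. \<exists>b'\<in>border n Oid. f t b = f t' b')"
proof -
  have fin: "finite Oid" and sub: "Oid \<subseteq> terms_in {..<n}"
    using Oid by (auto simp: order_ideal_def)
  \<comment> \<open>The total degree is bounded on the finite set \<open>Oid\<close>, so
    \<open>D - deg t\<close> falls when the head is multiplied by an indeterminate. This is the
    second component of the termination measure.\<close>
  define deg where "deg = (\<lambda>t::nat trm. \<Sum>i<n. Poly_Mapping.lookup t i)"
  define D where "D = Max (deg ` Oid)"
  have deg_le: "deg u \<le> D" if "u \<in> Oid" for u
    using that fin by (simp add: D_def)
  have deg_indet: "deg (indet_term i + u) = Suc (deg u)" if "i < n" for i u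
    using that by (simp add: deg_def lookup_add lookup_indet_term sum.distrib)
  have borderI: "indet_term i + u \<in> border n Oid" if "i < n" "u \<in> Oid" "indet_term i + u \<notin> Oid" for i u
    using that by (auto simp: border_def)
  have cancel: "u \<in> Oid" if "indet_term i + u \<in> Oid" for i u
    using order_ideal_indet_cancel[OF Oid that] .
  \<comment> \<open>Without such an exponent \<open>b\<close> would divide \<open>t\<close> and thus
    lie in \<open>Oid\<close>, contrary to being a border term.\<close>
  obtain k where k: "Poly_Mapping.lookup t k < Poly_Mapping.lookup b k"
  proof (rule ccontr)
    assume "\<not> thesis"
    then have "\<And>i. Poly_Mapping.lookup b i \<le> Poly_Mapping.lookup t i"
      using that not_le by blast
    then have "t = b + (t - b)"
      by (intro poly_mapping_eqI) (simp add: lookup_add lookup_minus)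
    then show False
      using order_ideal_dvd_closed[OF Oid] t b by (metis DiffD2 border_def)
  qed
  have "Poly_Mapping.keys b \<subseteq> {..<n}"
  proof -
    obtain i u where "i < n" "u \<in> Oid" "b = indet_term i + u"
      using b by (auto simp: border_def)
    moreover from this have "Poly_Mapping.keys u \<subseteq> {..<n}"
      using sub by (auto simp: terms_in_def)
    ultimately show ?thesis
      using keys_add[of "indet_term i" u] by (auto simp: indet_term_def split: if_splits)
  qed
  then have kn: "k < n"
    using k by (metis gr_implies_not0 in_keys_iff lessThan_iff subsetD)
  show ?thesis
    using t b k
  proof (induction "(Poly_Mapping.lookup t k, D - deg t)" arbitrary: t b
      rule: wf_induct_rule[OF wf_lex_prod[OF wf_less_than wf_less_than]])
    case 1
    note t = \<open>t \<in> Oid\<close> and b = \<open>b \<in> border n Oid\<close> and k = \<open>Poly_Mapping.lookup t k < Poly_Mapping.lookup b k\<close>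
    \<comment> \<open>The induction hypothesis for one translation: \<open>k\<close> stays fixed,
      and either t_k falls, or it is kept while the degree of the head rises.\<close>
    have step: ?case
      if "f t b = f t' b'" "t' \<in> Oid" "b' \<in> border n Oid" "Poly_Mapping.lookup t' k < Poly_Mapping.lookup b' k"
        and "Poly_Mapping.lookup t' k < Poly_Mapping.lookup t k \<or> Poly_Mapping.lookup t' k = Poly_Mapping.lookup t k \<and> deg t < deg t'" for t' b'
    proof -
      have "((Poly_Mapping.lookup t' k, D - deg t'), (Poly_Mapping.lookup t k, D - deg t)) \<in> less_than <*lex*> less_than"
        using that deg_le[of t'] by auto
      from 1(1)[OF this] that show ?thesis by metis
    qed
    \<comment> \<open>Dividing head and tail by x_k ends at \<open>z\<close> if t_k = 0. Otherwise
      t_k falls by one and b_k by at most one, so the strict inequality survives.\<close>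
    have drop: ?case
      if "f t b = g k t b'" "b' \<in> border n Oid" "Poly_Mapping.lookup b k \<le> Suc (Poly_Mapping.lookup b' k)" for b'
    proof (cases "Poly_Mapping.lookup t k > 0")
      case True
      show ?thesis
      proof (rule step[of "t - indet_term k" b'])
        show "t - indet_term k \<in> Oid"
          using cancel[of k] indet_term_plus_minus[OF True] t by metis
      qed (use True that k in \<open>auto simp: g_def lookup_minus lookup_indet_term\<close>)
    qed (use that in \<open>auto simp: g_def\<close>)
    show ?case
    proof (cases "t \<in> rim n Oid")
      case False
      \<comment> \<open>Off the rim every x_i t stays in \<open>Oid\<close>, so the head can be
        multiplied by any indeterminate.\<close>
      then have up: "indet_term i + t \<in> Oid" if "i < n" for i
        using that t borderI by (auto simp: rim_def)
      define m where "m = b - indet_term k"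
      have bm: "b = indet_term k + m"
        using indet_term_plus_minus[of b k] k by (simp add: m_def)
      show ?thesis
      proof (cases "m \<in> Oid")
        case True
        \<comment> \<open>The bound \<open>n \<ge> 2\<close> supplies a second indeterminate x_l.
          Reading the arrow as one with head x_l t shifted by x_l brings it into the form that both
          translation rules accept.\<close>
        obtain l where l: "l < n" "l \<noteq> k"
          using n that[of 0] that[of 1] by (cases "k = 0") auto
        have lt: "Poly_Mapping.lookup (indet_term l + t) l > 0" "indet_term l + t - indet_term l = t"
          by (simp_all add: lookup_add lookup_indet_term)
        then have g: "g l (indet_term l + t) b = f t b"
          by (simp add: g_def)
        show ?thesis
        proof (cases "indet_term l + m \<in> Oid")
          case True
          \<comment> \<open>Head and tail are both multiplied by x_l. The exponents at
            \<open>k\<close> do not change, and the degree of the head grows.\<close>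
          have eq: "f t b = f (indet_term l + t) (indet_term l + b)"
            using next_door[of l k "indet_term l + t" m] l kn up b True bm g by simp
          have "indet_term l + b \<notin> Oid"
            using cancel[of l b] b by (auto simp: border_def)
          then have "indet_term k + (indet_term l + m) \<in> border n Oid"
            using borderI[of k "indet_term l + m"] kn True by (simp add: bm add.left_commute)
          then have "indet_term l + b \<in> border n Oid"
            by (simp add: bm add.left_commute)
          from step[OF eq up[OF l(1)] this] show ?thesis
            using k l by (simp add: deg_indet lookup_add lookup_indet_term)
        next
          case False
          then have lm: "indet_term l + m \<in> border n Oid"
            using borderI l \<open>m \<in> Oid\<close> by blast
          \<comment> \<open>Both x_k m and x_l m are border terms. The tail moves from the first to
            the second and the head becomes x_l t / x_k, so both exponents at \<open>k\<close> fall
            by one; for t_k = 0 the value is \<open>z\<close>.\<close>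
          have eq: "f t b = g k (indet_term l + t) (indet_term l + m)"
            using across[of k l "indet_term l + t" m] l kn up \<open>m \<in> Oid\<close> b bm lm g by simp
          show ?thesis
          proof (cases "Poly_Mapping.lookup t k > 0")
            case True
            let ?t = "indet_term l + t - indet_term k"
            have pos: "Poly_Mapping.lookup (indet_term l + t) k > 0"
              using True by (simp add: lookup_add)
            have "f t b = f ?t (indet_term l + m)"
              using eq pos by (simp add: g_def)
            moreover have "?t \<in> Oid"
              using cancel[of k] indet_term_plus_minus[OF pos] up[OF l(1)] by metis
            ultimately show ?thesis
              using lm by (rule step) (use k l True in \<open>auto simp: bm lookup_add lookup_minus lookup_indet_term\<close>)
          next
            case False
            then show ?thesis
              using eq l by (simp add: g_def lookup_add lookup_indet_term)
          qed
        qed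
      next
        case False
        \<comment> \<open>As b / x_k is not in \<open>Oid\<close>, the border term \<open>b\<close>
          arises from \<open>Oid\<close> through another index \<open>l\<close>. With v = b / (x_k
          x_l), the term x_k v lies in \<open>Oid\<close> and m = x_l v on the border, which is the
          setting of \<open>next_door\<close>.\<close>
        obtain l u where l: "l < n" "u \<in> Oid" "b = indet_term l + u"
          using b by (auto simp: border_def)
        with False bm have "l \<noteq> k"
          by auto
        have "Poly_Mapping.lookup u k > 0"
          using k l \<open>l \<noteq> k\<close> by (auto simp: lookup_add lookup_indet_term)
        define v where "v = u - indet_term k"
        have uv: "u = indet_term k + v"
          using indet_term_plus_minus[OF \<open>Poly_Mapping.lookup u k > 0\<close>] by (simp add: v_def)
        have "indet_term k + (indet_term l + v) = indet_term k + m"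
          using bm l uv by (simp add: add.left_commute)
        then have m: "m = indet_term l + v"
          by simp
        have "m \<in> border n Oid"
          using borderI[of l v] l cancel[of k v] uv m False by auto
        then have "g k t m = f t b"
          using next_door[of k l t v] kn l \<open>l \<noteq> k\<close> t m uv bm by simp
        then show ?thesis
          using \<open>m \<in> border n Oid\<close> by (intro drop[of m]) (auto simp: bm lookup_add lookup_indet_term)
      qed
    qed (use b in auto)
  qed
qed

section \<open>Cotangent classes\<close>

lemma mpoly_ring_simps [simp]:
  "p \<in> carrier (mpoly_ring V) \<longleftrightarrow> Poly_Mapping.keys p \<subseteq> terms_in V"
  "p \<otimes>\<^bsub>mpoly_ring V\<^esub> q = p * q" "p \<oplus>\<^bsub>mpoly_ring V\<^esub> q = p + q"
  "\<one>\<^bsub>mpoly_ring V\<^esub> = 1" "\<zero>\<^bsub>mpoly_ring V\<^esub> = 0"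
  by (simp_all add: mpoly_ring_def)

lemma mpoly_ring_cring: "cring (mpoly_ring V :: ('v, 'k::field) mpoly ring)"
proof (rule cringI)
  show "abelian_group (mpoly_ring V :: ('v, 'k) mpoly ring)"
  proof (rule abelian_groupI)
    fix p :: "('v, 'k) mpoly"
    assume "p \<in> carrier (mpoly_ring V)"
    then show "\<exists>q\<in>carrier (mpoly_ring V). q \<oplus>\<^bsub>mpoly_ring V\<^esub> p = \<zero>\<^bsub>mpoly_ring V\<^esub>"
      by (intro bexI[of _ "- p"]) auto
  qed (auto simp: add_ac dest: subsetD[OF keys_add])
  have "0 \<in> terms_in V" and "\<And>s t. s \<in> terms_in V \<Longrightarrow> t \<in> terms_in V \<Longrightarrow> s + t \<in> terms_in V"
    by (auto simp: terms_in_def dest: subsetD[OF keys_add])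
  then show "Group.comm_monoid (mpoly_ring V :: ('v, 'k) mpoly ring)"
    by (intro comm_monoidI) (auto simp: mult_ac dest!: subsetD[OF keys_mult])
qed (simp add: distrib_right)

lemma mpoly_carrier_sum:
  assumes "\<And>x. x \<in> A \<Longrightarrow> h x \<in> carrier (mpoly_ring V)"
  shows "sum h A \<in> carrier (mpoly_ring V)"
  using assms
proof (induction A rule: infinite_finite_induct)
  case (insert x A)
  then have "h x \<oplus>\<^bsub>mpoly_ring V\<^esub> sum h A \<in> carrier (mpoly_ring V)"
    by (intro ring.ring_simprules(1)[OF cring.axioms(1)[OF mpoly_ring_cring]]) auto
  then show ?case
    using insert by simp
qed simp_all

lemma poly_indet_carrier: "v \<in> V \<Longrightarrow> poly_indet v \<in> carrier (mpoly_ring V)"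
  by (simp add: poly_indet_def indet_term_def terms_in_def)

lemma poly_indet_in_indet_ideal: "v \<in> V \<Longrightarrow> poly_indet v \<in> indet_ideal V"
  unfolding indet_ideal_def
  by (rule subsetD[OF ring.genideal_self[OF cring.axioms(1)[OF mpoly_ring_cring]]])
    (auto intro: poly_indet_carrier simp del: mpoly_ring_simps)

lemma indet_ideal_is_ideal: "ideal (indet_ideal V) (mpoly_ring V :: ('v, 'k::field) mpoly ring)"
  unfolding indet_ideal_def
  by (rule ring.genideal_ideal[OF cring.axioms(1)[OF mpoly_ring_cring]])
    (auto intro: poly_indet_carrier simp del: mpoly_ring_simps)

section \<open>Computing with residues in the cotangent ring\<close>

locale mpoly_ideal =
  fixes V :: "'v set" and I :: "('v, 'k::field) mpoly set"
  assumes ideal: "ideal I (mpoly_ring V)"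
begin

sublocale R: cring "mpoly_ring V :: ('v, 'k) mpoly ring"
  by (rule mpoly_ring_cring)

sublocale I: ideal I "mpoly_ring V :: ('v, 'k) mpoly ring"
  by (rule ideal)

sublocale Q: cring "mpoly_ring V Quot I"
  by (rule I.quotient_is_cring[OF mpoly_ring_cring])

lemma residue_max_ideal_is_ideal: "ideal (residue_max_ideal V I) (mpoly_ring V Quot I)"
  unfolding residue_max_ideal_def
  by (rule R.ring_ideal_imp_quot_ideal[OF ideal indet_ideal_is_ideal])

sublocale S: ideal "residue_max_ideal_sq V I" "mpoly_ring V Quot I"
  unfolding residue_max_ideal_sq_def
  by (rule Q.ideal_prod_is_ideal[OF residue_max_ideal_is_ideal residue_max_ideal_is_ideal])

text \<open>The residue map is the composite of the two quotient homomorphisms, first modulo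
  \<open>I\<close> and then modulo the square of the image of the maximal ideal.\<close>

sublocale residue: ring_hom_ring "mpoly_ring V" "cotangent_ring V I" "residue V I"
proof (rule ring_hom_ringI2)
  show "ring (cotangent_ring V I)"
    unfolding cotangent_ring_def by (rule S.quotient_is_ring)
  show "residue V I \<in> Ring.ring_hom (mpoly_ring V) (cotangent_ring V I)"
    using ring_hom_trans[OF I.rcos_ring_hom S.rcos_ring_hom]
    unfolding residue_def cotangent_ring_def by (simp add: o_def)
qed (rule R.ring_axioms)

lemma residue_zero: "residue V I 0 = \<zero>\<^bsub>cotangent_ring V I\<^esub>"
  using residue.hom_zero by simp

lemma residue_ideal:
  assumes "p \<in> I"
  shows "residue V I p = \<zero>\<^bsub>cotangent_ring V I\<^esub>"
proof -
  have "I +>\<^bsub>mpoly_ring V\<^esub> p = \<zero>\<^bsub>mpoly_ring V Quot I\<^esub>"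
    using I.a_rcos_const[OF assms] by (simp add: FactRing_def)
  then show ?thesis
    using S.a_rcos_const[OF S.zero_closed] by (simp add: residue_def cotangent_ring_def FactRing_def)
qed

text \<open>Both factors map into the maximal ideal, so their product maps into its square. This
  removes the quadratic terms of the commutators.\<close>

lemma residue_indet_mult:
  assumes "v \<in> V" "w \<in> V"
  shows "residue V I (poly_indet v * poly_indet w) = \<zero>\<^bsub>cotangent_ring V I\<^esub>"
proof -
  let ?h = "\<lambda>p. I +>\<^bsub>mpoly_ring V\<^esub> p"
  have "?h (poly_indet v * poly_indet w) = ?h (poly_indet v) \<otimes>\<^bsub>mpoly_ring V Quot I\<^esub> ?h (poly_indet w)"
    using ring_hom_mult[OF I.rcos_ring_hom poly_indet_carrier poly_indet_carrier] assms by simp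
  also have "\<dots> \<in> residue_max_ideal_sq V I"
    unfolding residue_max_ideal_sq_def residue_max_ideal_def
    using assms by (intro ideal_prod.prod imageI poly_indet_in_indet_ideal)
  finally show ?thesis
    using S.a_rcos_const by (simp add: residue_def cotangent_ring_def FactRing_def)
qed

lemma residue_add_zero:
  assumes "p \<in> carrier (mpoly_ring V)" "q \<in> carrier (mpoly_ring V)"
    "residue V I q = \<zero>\<^bsub>cotangent_ring V I\<^esub>"
  shows "residue V I (p + q) = residue V I p"
  using residue.hom_add[OF assms(1,2)] assms(1,3) residue.hom_closed[OF assms(1)] by simp

lemma residue_sum_zero:
  assumes "\<And>x. x \<in> A \<Longrightarrow> h x \<in> carrier (mpoly_ring V)"
    and "\<And>x. x \<in> A \<Longrightarrow> residue V I (h x) = \<zero>\<^bsub>cotangent_ring V I\<^esub>"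
  shows "residue V I (sum h A) = \<zero>\<^bsub>cotangent_ring V I\<^esub>"
  using assms
proof (induction A rule: infinite_finite_induct)
  case (insert x A)
  then have "residue V I (h x + sum h A) = residue V I (h x)"
    by (intro residue_add_zero mpoly_carrier_sum) auto
  then show ?case
    using insert by simp
qed (simp_all add: residue_zero)

text \<open>Meant for entries of matrix products in which a single summand has a nonzero linear
  part.\<close>

lemma residue_sum_single:
  assumes "finite A" "a \<in> A"
    and "\<And>x. x \<in> A \<Longrightarrow> h x \<in> carrier (mpoly_ring V)"
    and "\<And>x. x \<in> A \<Longrightarrow> x \<noteq> a \<Longrightarrow> residue V I (h x) = \<zero>\<^bsub>cotangent_ring V I\<^esub>"
  shows "residue V I (sum h A) = residue V I (h a)"
proof -
  have "sum h (A - {a}) \<in> carrier (mpoly_ring V)"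
    "residue V I (sum h (A - {a})) = \<zero>\<^bsub>cotangent_ring V I\<^esub>"
    using residue_sum_zero[of "A - {a}" h] mpoly_carrier_sum[of "A - {a}" h] assms by auto
  then show ?thesis
    using residue_add_zero[of "h a"] assms by (simp add: sum.remove)
qed

lemma residue_eq_of_diff:
  assumes "p \<in> carrier (mpoly_ring V)" "q \<in> carrier (mpoly_ring V)" "p - q \<in> I"
  shows "residue V I p = residue V I q"
proof -
  have "p - q \<in> carrier (mpoly_ring V)"
    using assms(3) I.a_subset by blast
  then show ?thesis
    using residue_add_zero[of q "p - q"] assms residue_ideal by simp
qed

text \<open>Equality of residues is stronger than equality of the lines they span. It suffices
  because translations preserve the residue itself, with no scalar factor.\<close>

lemma cotangent_equivI:
  assumes "c \<in> V" "d \<in> V" "residue V I (poly_indet c) = residue V I (poly_indet d)"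
  shows "(c, d) \<in> cotangent_equiv V I"
  using assms by (simp add: cotangent_equiv_def cotangent_line_def)

end

section \<open>Linear parts of the commutators\<close>

lemma position_nth:
  assumes "distinct xs" "x \<in> set xs"
  shows "position xs x < length xs" "xs ! position xs x = x"
proof -
  have "\<exists>!m. m < length xs \<and> xs ! m = x"
    using assms by (metis distinct_Ex1)
  from theI'[OF this] show "position xs x < length xs" "xs ! position xs x = x"
    by (simp_all add: position_def)
qed

lemma nth_position:
  assumes "distinct xs" "i < length xs"
  shows "position xs (xs ! i) = i"
  using position_nth[of xs "xs ! i"] assms nth_eq_iff_index_eq by fastforce

lemma generic_mult_mat_index:
  assumes "i < length ts" "j < length ts"
  shows "generic_mult_mat ts bs k $$ (i, j) =
    (if indet_term k + ts ! j \<in> set ts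
     then if i = position ts (indet_term k + ts ! j) then 1 else 0
     else poly_indet (i, position bs (indet_term k + ts ! j)))"
  using assms by (auto simp: generic_mult_mat_def mat_of_cols_index Let_def unit_vec_def)

lemma mult_mat_index:
  assumes "A \<in> carrier_mat m m" "B \<in> carrier_mat m m" "i < m" "j < m"
  shows "(A * B) $$ (i, j) = (\<Sum>r<m. A $$ (i, r) * B $$ (r, j))"
  using assms by (simp add: scalar_prod_def lessThan_atLeast0)

section \<open>Commutator entries as elements of the defining ideal\<close>

locale border_scheme =
  fixes n :: nat and ts bs :: "nat trm list" and I :: "(nat \<times> nat, 'k::field) mpoly set"
  assumes order_ideal: "order_ideal n (set ts)" and distinct_ts: "distinct ts"
    and set_bs: "set bs = border n (set ts)" and distinct_bs: "distinct bs"
    and I_def: "I = border_scheme_ideal n ts bs"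
begin

abbreviation mult_mat :: "nat \<Rightarrow> (nat \<times> nat, 'k) mpoly mat" where
  "mult_mat \<equiv> generic_mult_mat ts bs"

abbreviation coord :: "nat trm \<Rightarrow> nat trm \<Rightarrow> nat \<times> nat" where
  "coord t b \<equiv> (position ts t, position bs b)"

lemma mult_mat_carrier: "mult_mat k \<in> carrier_mat (length ts) (length ts)"
  by (simp add: generic_mult_mat_def carrier_matI)

lemma borderI: "k < n \<Longrightarrow> t \<in> set ts \<Longrightarrow> indet_term k + t \<notin> set ts \<Longrightarrow> indet_term k + t \<in> set bs"
  by (auto simp: set_bs border_def)

lemma index_in_coord_indets:
  "i < length ts \<Longrightarrow> b \<in> set bs \<Longrightarrow> (i, position bs b) \<in> coord_indets ts bs"
  using position_nth[OF distinct_bs] by (simp add: coord_indets_def)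

lemma mult_mat_entry_carrier:
  assumes "k < n" "i < length ts" "j < length ts"
  shows "mult_mat k $$ (i, j) \<in> carrier (mpoly_ring (coord_indets ts bs))"
proof (cases "indet_term k + ts ! j \<in> set ts")
  case True
  then show ?thesis
    using assms by (simp add: generic_mult_mat_index terms_in_def)
next
  case False
  then have "(i, position bs (indet_term k + ts ! j)) \<in> coord_indets ts bs"
    using assms borderI index_in_coord_indets by simp
  then show ?thesis
    using poly_indet_carrier False assms by (simp add: generic_mult_mat_index del: mpoly_ring_simps)
qed

lemma mult_mat_prod_carrier:
  assumes "k < n" "l < n" "i < length ts" "j < length ts"
  shows "(mult_mat k * mult_mat l) $$ (i, j) \<in> carrier (mpoly_ring (coord_indets ts bs))"
proof -
  have "mult_mat k $$ (i, r) * mult_mat l $$ (r, j) \<in> carrier (mpoly_ring (coord_indets ts bs))"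
    if "r < length ts" for r
    using ring.ring_simprules(5)[OF cring.axioms(1)[OF mpoly_ring_cring]
        mult_mat_entry_carrier[OF assms(1,3) that] mult_mat_entry_carrier[OF assms(2) that assms(4)]]
    by simp
  then show ?thesis
    unfolding mult_mat_index[OF mult_mat_carrier mult_mat_carrier assms(3,4)]
    by (intro mpoly_carrier_sum) auto
qed

lemma commutator_index:
  assumes "i < length ts" "j < length ts"
  shows "(mult_mat k * mult_mat l - mult_mat l * mult_mat k) $$ (i, j) =
    (mult_mat k * mult_mat l) $$ (i, j) - (mult_mat l * mult_mat k) $$ (i, j)"
  using assms mult_mat_carrier[of k] mult_mat_carrier[of l] by auto

lemma commutator_carrier:
  "mult_mat k * mult_mat l - mult_mat l * mult_mat k \<in> carrier_mat (length ts) (length ts)"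
  using mult_mat_carrier[of k] mult_mat_carrier[of l] by auto

lemma generators_carrier:
  "(\<Union>j<n. \<Union>i<j. elements_mat (mult_mat i * mult_mat j - mult_mat j * mult_mat i))
    \<subseteq> carrier (mpoly_ring (coord_indets ts bs))"
proof safe
  fix i j p
  assume ij: "j < n" "i < j" and p: "p \<in> elements_mat (mult_mat i * mult_mat j - mult_mat j * mult_mat i)"
  obtain r c where rc: "r < length ts" "c < length ts"
    and "p = (mult_mat i * mult_mat j - mult_mat j * mult_mat i) $$ (r, c)"
    using elements_matD[OF p] commutator_carrier[of i j] by (metis carrier_matD)
  then have "p = (mult_mat i * mult_mat j) $$ (r, c) - (mult_mat j * mult_mat i) $$ (r, c)"
    by (simp only: commutator_index)
  then show "p \<in> carrier (mpoly_ring (coord_indets ts bs))"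
    using ij rc mult_mat_prod_carrier[of i j r c] mult_mat_prod_carrier[of j i r c]
      keys_diff[of "(mult_mat i * mult_mat j) $$ (r, c)" "(mult_mat j * mult_mat i) $$ (r, c)"]
    by auto
qed

sublocale mpoly_ideal "coord_indets ts bs" I
  using ring.genideal_ideal[OF cring.axioms(1)[OF mpoly_ring_cring] generators_carrier]
  by (intro mpoly_ideal.intro) (simp add: I_def border_scheme_ideal_def)

text \<open>The generators cover only pairs with the smaller index first. The reversed pairs follow
  by symmetry of the equation, and equal indices are trivial.\<close>

lemma residue_commutator:
  assumes "k < n" "l < n" "i < length ts" "j < length ts"
  shows "residue (coord_indets ts bs) I ((mult_mat k * mult_mat l) $$ (i, j)) =
    residue (coord_indets ts bs) I ((mult_mat l * mult_mat k) $$ (i, j))"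
proof -
  have *: "residue (coord_indets ts bs) I ((mult_mat k * mult_mat l) $$ (i, j)) =
    residue (coord_indets ts bs) I ((mult_mat l * mult_mat k) $$ (i, j))"
    if "l < n" "k < l" for k l
  proof (rule residue_eq_of_diff)
    have "(mult_mat k * mult_mat l) $$ (i, j) - (mult_mat l * mult_mat k) $$ (i, j)
      \<in> elements_mat (mult_mat k * mult_mat l - mult_mat l * mult_mat k)"
      by (rule elements_matI[OF commutator_carrier assms(3,4)]) (simp only: commutator_index assms)
    then show "(mult_mat k * mult_mat l) $$ (i, j) - (mult_mat l * mult_mat k) $$ (i, j) \<in> I"
      using subsetD[OF R.genideal_self[OF generators_carrier]] that
      unfolding I_def border_scheme_ideal_def by blast
  qed (use that assms in \<open>auto intro!: mult_mat_prod_carrier simp del: mpoly_ring_simps\<close>)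
  show ?thesis
    using *[of l k] *[of k l] assms by (metis nat_neq_iff)
qed

section \<open>Translation rules for arrows, and the passage to the rim\<close>

abbreviation arrow :: "nat trm \<Rightarrow> nat trm \<Rightarrow> (nat \<times> nat, 'k) mpoly set set" where
  "arrow t b \<equiv> residue (coord_indets ts bs) I (poly_indet (coord t b))"

text \<open>This is the function \<open>g\<close> of \<open>arrow_reaches_rim\<close> for
  \<open>arrow\<close>. The value zero stands for a head whose exponent at \<open>k\<close> would
  become negative.\<close>

abbreviation shifted_arrow :: "nat \<Rightarrow> nat trm \<Rightarrow> nat trm \<Rightarrow> (nat \<times> nat, 'k) mpoly set set" where
  "shifted_arrow k s b \<equiv> if Poly_Mapping.lookup s k > 0 then arrow (s - indet_term k) b
     else \<zero>\<^bsub>cotangent_ring (coord_indets ts bs) I\<^esub>"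

text \<open>The column of \<open>m\<close> in the right factor is a unit vector, so the product
  entry is one entry of the left factor. That entry is an indeterminate because the final term
  leaves the order ideal.\<close>

lemma residue_prod_inside:
  assumes "k < n" "s \<in> set ts" "indet_term l + m \<in> set ts" "m \<in> set ts"
    and "indet_term k + (indet_term l + m) \<notin> set ts"
  shows "residue (coord_indets ts bs) I ((mult_mat k * mult_mat l) $$ (position ts s, position ts m)) =
    arrow s (indet_term k + (indet_term l + m))"
proof -
  note pos = position_nth[OF distinct_ts]
  have "(mult_mat k * mult_mat l) $$ (position ts s, position ts m) =
    (\<Sum>r<length ts. if r = position ts (indet_term l + m) then mult_mat k $$ (position ts s, r) else 0)"
    unfolding mult_mat_index[OF mult_mat_carrier mult_mat_carrier pos(1)[OF assms(2)] pos(1)[OF assms(4)]]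
    using assms pos by (intro sum.cong) (auto simp: generic_mult_mat_index)
  also have "\<dots> = mult_mat k $$ (position ts s, position ts (indet_term l + m))"
    using pos assms by simp
  finally show ?thesis
    using pos assms by (simp add: generic_mult_mat_index)
qed

text \<open>The column of \<open>m\<close> in the right factor consists of indeterminates, so modulo
  quadratic terms only entries 1 in the row of \<open>s\<close> of the left factor count. Such an
  entry sits only in the column of s / x_k, if that term exists.\<close>

lemma residue_prod_border:
  assumes k: "k < n" and l: "l < n" and s: "s \<in> set ts" and m: "m \<in> set ts"
    and b: "indet_term l + m \<notin> set ts"
  shows "residue (coord_indets ts bs) I ((mult_mat k * mult_mat l) $$ (position ts s, position ts m)) =
    shifted_arrow k s (indet_term l + m)"
proof -
  note pos = position_nth[OF distinct_ts]
  let ?b = "indet_term l + m" and ?res = "residue (coord_indets ts bs) I"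
  let ?h = "\<lambda>r. mult_mat k $$ (position ts s, r) * poly_indet (r, position bs ?b)"
  have bs: "?b \<in> set bs"
    using borderI l m b .
  have prod: "(mult_mat k * mult_mat l) $$ (position ts s, position ts m) = (\<Sum>r<length ts. ?h r)"
    unfolding mult_mat_index[OF mult_mat_carrier mult_mat_carrier pos(1)[OF s] pos(1)[OF m]]
    using b pos m by (intro sum.cong) (auto simp: generic_mult_mat_index)
  have carrier: "?h r \<in> carrier (mpoly_ring (coord_indets ts bs))" if "r < length ts" for r
    using R.m_closed[OF mult_mat_entry_carrier poly_indet_carrier[OF index_in_coord_indets]]
      that k bs pos[OF s] by simp
  \<comment> \<open>The left factor of the summand is 0 if x_k t_r stays inside at a term other than
    \<open>s\<close>, and an indeterminate if x_k t_r is a border term; the summand is then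
    quadratic.\<close>
  have zero: "?res (?h r) = \<zero>\<^bsub>cotangent_ring (coord_indets ts bs) I\<^esub>"
    if r: "r < length ts" and "indet_term k + ts ! r \<noteq> s" for r
  proof (cases "indet_term k + ts ! r \<in> set ts")
    case True
    then have "position ts s \<noteq> position ts (indet_term k + ts ! r)"
      using pos s that by metis
    then show ?thesis
      using True r pos s by (simp add: generic_mult_mat_index residue_zero)
  next
    case False
    then have "indet_term k + ts ! r \<in> set bs"
      using borderI k r by simp
    then show ?thesis
      using False r pos s bs
      by (simp add: generic_mult_mat_index residue_indet_mult index_in_coord_indets)
  qed
  show ?thesis
  proof (cases "Poly_Mapping.lookup s k > 0")
    case True
    let ?u = "s - indet_term k"
    have u: "indet_term k + ?u = s" "?u \<in> set ts"
      using indet_term_plus_minus[OF True] order_ideal_indet_cancel[OF order_ideal, of k ?u] s by simp_all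
    have "?res (\<Sum>r<length ts. ?h r) = ?res (?h (position ts ?u))"
    proof (rule residue_sum_single)
      fix r
      assume r: "r \<in> {..<length ts}" "r \<noteq> position ts ?u"
      then have "ts ! r \<noteq> ?u"
        using nth_position[OF distinct_ts, of r] by force
      then have "indet_term k + ts ! r \<noteq> s"
        using u(1) by (metis add_left_cancel)
      then show "?res (?h r) = \<zero>\<^bsub>cotangent_ring (coord_indets ts bs) I\<^esub>"
        using zero r by simp
    qed (use carrier pos u in auto)
    also have "?h (position ts ?u) = poly_indet (coord ?u ?b)"
      using pos u s by (simp add: generic_mult_mat_index)
    finally show ?thesis
      using True prod by simp
  next
    case False
    then have "indet_term k + ts ! r \<noteq> s" for r
      by (auto simp: lookup_add lookup_indet_term)
    then show ?thesis
      using residue_sum_zero[of "{..<length ts}" ?h] carrier zero False prod by auto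
  qed
qed

text \<open>The walk is applied to cotangent classes with \<open>z\<close> the zero class, which
  non-triviality of \<open>c\<close> excludes as an outcome.\<close>

lemma class_meets_rim:
  assumes "n \<ge> 2" and c: "c \<in> coord_indets ts bs"
    and nontrivial: "\<not> trivial_indet (coord_indets ts bs) I c"
  obtains d where "d \<in> coord_indets ts bs" "rim_indet n ts d" "(c, d) \<in> cotangent_equiv (coord_indets ts bs) I"
proof -
  obtain i j where ij: "c = (i, j)" "i < length ts" "j < length bs"
    using c by (auto simp: coord_indets_def)
  note pos = position_nth[OF distinct_ts]
  have coord: "c = coord (ts ! i) (bs ! j)"
    using nth_position distinct_ts distinct_bs ij by metis
  have outside: "b \<notin> set ts" if "b \<in> border n (set ts)" for b
    using that by (simp add: border_def)
  have cancel: "u \<in> set ts" if "indet_term k + u \<in> set ts" for k u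
    using order_ideal_indet_cancel[OF order_ideal that] .
  have "arrow (ts ! i) (bs ! j) = \<zero>\<^bsub>cotangent_ring (coord_indets ts bs) I\<^esub> \<or>
    (\<exists>t'\<in>rim n (set ts). \<exists>b'\<in>border n (set ts). arrow (ts ! i) (bs ! j) = arrow t' b')"
  proof (rule arrow_reaches_rim[OF assms(1) order_ideal])
    \<comment> \<open>Rule \<open>next_door\<close>: the entry at \<open>s\<close> and
      \<open>m\<close> is computed in both orders of the factors. One order passes through the
      border term x_l m, the other through x_k m inside the order ideal.\<close>
    fix k l m s
    assume *: "k < n" "l < n" "s \<in> set ts" "indet_term l + m \<in> border n (set ts)" "indet_term k + m \<in> set ts"
    then have m: "m \<in> set ts" and out: "indet_term l + (indet_term k + m) \<notin> set ts"
      using cancel[of k m] outside cancel[of k "indet_term l + m"] by (auto simp: add.left_commute)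
    have "shifted_arrow k s (indet_term l + m) =
      residue (coord_indets ts bs) I ((mult_mat k * mult_mat l) $$ (position ts s, position ts m))"
      using residue_prod_border[of k l s m] * m outside by simp
    also have "\<dots> = residue (coord_indets ts bs) I ((mult_mat l * mult_mat k) $$ (position ts s, position ts m))"
      using residue_commutator * m pos by simp
    also have "\<dots> = arrow s (indet_term k + (indet_term l + m))"
      using residue_prod_inside[of l s k m] * m out by (simp add: add.left_commute)
    finally show "shifted_arrow k s (indet_term l + m) = arrow s (indet_term k + (indet_term l + m))" .
  next
    \<comment> \<open>Rule \<open>across\<close>: both orders pass through the border, so each side
      is a shifted arrow.\<close>
    fix k l m s
    assume *: "k < n" "l < n" "s \<in> set ts" "m \<in> set ts"
      "indet_term l + m \<in> border n (set ts)" "indet_term k + m \<in> border n (set ts)"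
    then show "shifted_arrow k s (indet_term l + m) = shifted_arrow l s (indet_term k + m)"
      using residue_prod_border[of k l s m] residue_prod_border[of l k s m] outside
        residue_commutator[of k l "position ts s" "position ts m"] pos by simp
  qed (use ij set_bs nth_mem in auto)
  moreover have "arrow (ts ! i) (bs ! j) \<noteq> \<zero>\<^bsub>cotangent_ring (coord_indets ts bs) I\<^esub>"
    using nontrivial c coord by (simp add: trivial_indet_def)
  ultimately obtain t b where tb: "t \<in> rim n (set ts)" "b \<in> border n (set ts)"
    and eq: "arrow (ts ! i) (bs ! j) = arrow t b"
    by auto
  have t: "t \<in> set ts"
    using tb by (simp add: rim_def)
  show ?thesis
  proof
    show d: "coord t b \<in> coord_indets ts bs"
      using index_in_coord_indets tb pos[OF t] set_bs by simp
    show "rim_indet n ts (coord t b)"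
      using tb pos[OF t] by (simp add: rim_indet_def)
    show "(c, coord t b) \<in> cotangent_equiv (coord_indets ts bs) I"
      using cotangent_equivI[OF c d] eq coord by simp
  qed
qed

end

section \<open>Excluding fewer than two indeterminates, and the two assertions\<close>

text \<open>There is no pair of indices to form a commutator, so the generating set is
  empty.\<close>

lemma border_scheme_ideal_univariate:
  assumes "n \<le> 1"
  shows "border_scheme_ideal n ts bs = {0}"
proof -
  have empty: "(\<Union>j<n. \<Union>i<j. F i j) = {}" for F :: "nat \<Rightarrow> nat \<Rightarrow> 'b set"
    using assms by auto
  interpret R: cring "mpoly_ring (coord_indets ts bs)"
    by (rule mpoly_ring_cring)
  have "genideal (mpoly_ring (coord_indets ts bs)) {} \<subseteq> {0}"
    using R.genideal_minimal[OF R.zeroideal, of "{}"] by simp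
  moreover have "0 \<in> genideal (mpoly_ring (coord_indets ts bs)) {}"
    using additive_subgroup.zero_closed[OF ideal.axioms(1)[OF R.genideal_ideal[of "{}"]]] by simp
  ultimately show ?thesis
    unfolding border_scheme_ideal_def empty by blast
qed

theorem theorem6p7:
  fixes n :: nat
    and ts bs :: "nat trm list"
    and C Y :: "(nat \<times> nat) set"
    and I :: "(nat \<times> nat, 'k::field) mpoly set"
    and Z :: "(nat \<times> nat) list"
  assumes "order_ideal n (set ts)" and "distinct ts"
    and "set bs = border n (set ts)" and "distinct bs"
    and "C = coord_indets ts bs"
    and "I = border_scheme_ideal n ts bs"
    and "Z \<noteq> []" and "distinct Z" and "set Z \<subseteq> C"
    and "separating C I Z"
    and "Y = C - set Z"
  shows "(\<forall>c\<in>C. basic_indet C I c \<longrightarrow> rim_indet n ts c) \<and>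
         (\<forall>E. proper_class C I E \<longrightarrow> (\<exists>c\<in>E. rim_indet n ts c))"
proof -
  interpret border_scheme n ts bs I
    using assms by unfold_locales
  \<comment> \<open>A nonempty \<open>Z\<close> forces a nonzero element of \<open>I\<close>; this
    is how separation yields the two indeterminates needed for the walk.\<close>
  have "I \<noteq> {0}"
    using \<open>separating C I Z\<close> \<open>Z \<noteq> []\<close> by (fastforce simp: separating_def)
  then have n: "n \<ge> 2"
    using border_scheme_ideal_univariate[of n ts bs] I_def by fastforce
  have meet: "\<exists>d. rim_indet n ts d \<and> (c, d) \<in> cotangent_equiv C I"
    if "c \<in> C" "\<not> trivial_indet C I c" for c
    using class_meets_rim[OF n] that unfolding \<open>C = _\<close> by metis
  \<comment> \<open>The class of a basic indeterminate is a singleton, so the rim indeterminate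
    found in it is \<open>c\<close> itself.\<close>
  have "rim_indet n ts c" if "basic_indet C I c" for c
    using that meet[of c] unfolding basic_indet_def by (metis Image_singleton_iff singletonD)
  moreover have "\<exists>c\<in>E. rim_indet n ts c" if E: "proper_class C I E" for E
  proof -
    \<comment> \<open>Any representative will do, since every member of a proper class is
      non-trivial.\<close>
    obtain c where c: "c \<in> C" "E = cotangent_equiv C I `` {c}"
      using E unfolding proper_class_def by (metis quotientE)
    then have "c \<in> E"
      by (simp add: cotangent_equiv_def)
    then show ?thesis
      using E c meet[of c] unfolding proper_class_def by blast
  qed
  ultimately show ?thesis
    by blast
qed

end
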